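(* Let $\mathcal{H}$ be a collection of at least $9$ distinct sets. Then at least one of the matrices $S^3$, $\bar S^3$, $M^3$ can be found in $\mathcal{H}$. Hence $S(2,2)=8$.
   Context: A 0-1 matrix $N$ with $a$ rows and $b$ columns can be found in a collection of sets $\mathcal{H}$ if there are distinct sets $H_1,\dots,H_a\in\mathcal{H}$ and distinct elements $e_1,\dots,e_b\in\bigcup_{H\in\mathcal{H}}H$ such that $N_{\alpha,\beta}=1$ if and only if $e_\beta\in H_\alpha$. For an integer $n\ge 1$, the following matrices have $n+1$ rows and $n$ columns with entries in $\{0,1\}$: the $n$-singleton matrix $S^n$, with $S^n_{i,j}=1$ iff $i=j+1$; the $n$-cosingleton matrix $\bar S^n$, with $\bar S^n_{i,j}=0$ iff $i=j$; the $n$-monotone matrix $M^n$, with $M^n_{i,j}=1$ iff $i\ge j+1$. For non-negative integers $k,l$, $S(k,l)$ is the smallest non-negative integer $S$ such that for every collection of distinct sets $\mathcal{H}$ with $|\mathcal{H}|>S$, at least one of $S^{k+1}$, $\bar S^{l+1}$, $M^{\min(k+1,l+1)}$ can be found in $\mathcal{H}$ (such an integer exists). *)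

theory Defs
  imports "Jordan_Normal_Form.Matrix" "HOL-Library.Infinite_Typeclass"
begin

definition found_in :: "nat mat \<Rightarrow> 'a set set \<Rightarrow> bool" where
  "found_in N H \<longleftrightarrow>
     (\<exists>(Hs :: nat \<Rightarrow> 'a set) (es :: nat \<Rightarrow> 'a).
        inj_on Hs {..<dim_row N} \<and> Hs ` {..<dim_row N} \<subseteq> H \<and>
        inj_on es {..<dim_col N} \<and> es ` {..<dim_col N} \<subseteq> \<Union>H \<and>
        (\<forall>i<dim_row N. \<forall>j<dim_col N. N $$ (i, j) = 1 \<longleftrightarrow> es j \<in> Hs i))"

(* Matrix indices start at 0. The entries below depend only on how i compares with j or j + 1,
   so the formulas are the same for indices starting at 1. *)

definition singleton_mat :: "nat \<Rightarrow> nat mat" where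
  "singleton_mat n = mat (n + 1) n (\<lambda>(i, j). if i = j + 1 then 1 else 0)"

definition cosingleton_mat :: "nat \<Rightarrow> nat mat" where
  "cosingleton_mat n = mat (n + 1) n (\<lambda>(i, j). if i = j then 0 else 1)"

definition monotone_mat :: "nat \<Rightarrow> nat mat" where
  "monotone_mat n = mat (n + 1) n (\<lambda>(i, j). if i \<ge> j + 1 then 1 else 0)"

(* The collections range over sets of elements of 'a, and may be infinite; card is 0 on infinite
   collections, which are therefore listed separately. The type 'a has to be infinite: a small
   finite type would not contain all finite collections up to renaming of elements. *)

definition S_num :: "'a::infinite itself \<Rightarrow> nat \<Rightarrow> nat \<Rightarrow> nat" where
  "S_num _ k l =
     (LEAST s. \<forall>H :: 'a set set. infinite H \<or> card H > s \<longrightarrow>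
        found_in (singleton_mat (k + 1)) H \<or>
        found_in (cosingleton_mat (l + 1)) H \<or>
        found_in (monotone_mat (min (k + 1) (l + 1))) H)"

end

theory Submission
  imports Defs
begin

text \<open>
  Nine distinct sets are separated by a finite set \<open>X\<close> of elements; take \<open>X\<close> minimal.
  By minimality, for each \<open>x \<in> X\<close> there are two of the sets whose traces on \<open>X\<close> differ exactly in
  \<open>x\<close>, and this property passes to subsets of \<open>X\<close>. If none of the three matrices occurs, five such
  elements are contradictory, already for the ten sets that witness the property; so \<open>X\<close> has at most
  four elements, and an exhaustive search shows that at most eight traces on four elements are
  possible. A family of eight sets attaining this bound shows that 8 is optimal.
\<close>

section \<open>Traces on three elements and the forbidden patterns\<close>

definition trace :: "'a set set \<Rightarrow> 'a \<Rightarrow> 'a \<Rightarrow> 'a \<Rightarrow> bool \<Rightarrow> bool \<Rightarrow> bool \<Rightarrow> bool" where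
  "trace H x y z p q r \<longleftrightarrow> (\<exists>A\<in>H. (x \<in> A) = p \<and> (y \<in> A) = q \<and> (z \<in> A) = r)"

text \<open>The last six conjuncts exclude the monotone matrix, once for each order of its columns.\<close>

definition avoids :: "(bool \<Rightarrow> bool \<Rightarrow> bool \<Rightarrow> bool) \<Rightarrow> bool" where
  "avoids t \<longleftrightarrow>
     \<not> (t False False False \<and> t True False False \<and> t False True False \<and> t False False True) \<and>
     \<not> (t True True True \<and> t False True True \<and> t True False True \<and> t True True False) \<and>
     \<not> (t False False False \<and> t True True True \<and> t True False False \<and> t True True False) \<and>
     \<not> (t False False False \<and> t True True True \<and> t True False False \<and> t True False True) \<and>
     \<not> (t False False False \<and> t True True True \<and> t False True False \<and> t True True False) \<and>
     \<not> (t False False False \<and> t True True True \<and> t False True False \<and> t False True True) \<and>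
     \<not> (t False False False \<and> t True True True \<and> t False False True \<and> t True False True) \<and>
     \<not> (t False False False \<and> t True True True \<and> t False False True \<and> t False True True)"

text \<open>The patterns occur only as negated conjunctions, so having fewer traces preserves
  avoidance. This transfers avoidance to subfamilies and to the encodings \<open>avoids_from\<close>
  and \<open>list_trace\<close>.\<close>

lemma avoids_antimono:
  assumes "avoids t" "\<And>p q r. s p q r \<Longrightarrow> t p q r"
  shows "avoids s"
  using assms(1) unfolding avoids_def
  by (elim conjE, intro conjI; elim contrapos_nn conjE) (simp_all add: assms(2))

lemma less_4_3: "(i :: nat) < 4 \<longleftrightarrow> i = 0 \<or> i = 1 \<or> i = 2 \<or> i = 3" "i < 3 \<longleftrightarrow> i = 0 \<or> i = 1 \<or> i = 2"
  by auto

text \<open>Pairwise distinct rows force distinct sets, and a 1 in every column puts each element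
  into \<open>\<Union>H\<close>. Both side conditions of \<open>found_in\<close> therefore come for
  free from the traces.\<close>

lemma found_in_4_3_iff:
  assumes "dim_row N = 4" "dim_col N = 3"
    and rows: "\<And>i k. i < 4 \<Longrightarrow> k < 4 \<Longrightarrow> (\<forall>j<3. N $$ (i, j) = 1 \<longleftrightarrow> N $$ (k, j) = 1) \<Longrightarrow> i = k"
    and cols: "\<And>j. j < 3 \<Longrightarrow> \<exists>i<4. N $$ (i, j) = 1"
  shows "found_in N H \<longleftrightarrow>
    (\<exists>x y z. distinct [x, y, z] \<and> (\<forall>i<4. trace H x y z (N $$ (i, 0) = 1) (N $$ (i, 1) = 1) (N $$ (i, 2) = 1)))"
    (is "_ \<longleftrightarrow> ?R")
proof
  assume "found_in N H"
  then obtain Hs es where *: "Hs ` {..<4} \<subseteq> H" "inj_on es {..<3}"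
    "\<forall>i<4. \<forall>j<3. N $$ (i, j) = 1 \<longleftrightarrow> es j \<in> Hs i"
    unfolding found_in_def assms(1,2) by blast
  have "distinct [es 0, es 1, es 2]"
    using inj_onD[OF *(2), of 0 1] inj_onD[OF *(2), of 0 2] inj_onD[OF *(2), of 1 2] by auto
  moreover have "trace H (es 0) (es 1) (es 2) (N $$ (i, 0) = 1) (N $$ (i, 1) = 1) (N $$ (i, 2) = 1)"
    if "i < 4" for i
    unfolding trace_def using *(1,3) that by (intro bexI[of _ "Hs i"]) auto
  ultimately show ?R by blast
next
  assume ?R
  then obtain x y z where d: "distinct [x, y, z]"
    and "\<forall>i<4. \<exists>A\<in>H. (x \<in> A) = (N $$ (i, 0) = 1) \<and> (y \<in> A) = (N $$ (i, 1) = 1) \<and> (z \<in> A) = (N $$ (i, 2) = 1)"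
    unfolding trace_def by blast
  then obtain A where A: "\<And>i. i < 4 \<Longrightarrow> A i \<in> H \<and> (x \<in> A i) = (N $$ (i, 0) = 1)
      \<and> (y \<in> A i) = (N $$ (i, 1) = 1) \<and> (z \<in> A i) = (N $$ (i, 2) = 1)"
    by metis
  then have A_iff: "N $$ (i, j) = 1 \<longleftrightarrow> [x, y, z] ! j \<in> A i" if "i < 4" "j < 3" for i j
    using that by (auto simp: less_4_3(2))
  have "inj_on A {..<4}"
    by (rule inj_onI) (metis A_iff rows lessThan_iff)
  moreover have "inj_on ((!) [x, y, z]) {..<3}"
    using d by (intro inj_on_nth) auto
  moreover have "A ` {..<4} \<subseteq> H"
    using A by blast
  moreover have "(!) [x, y, z] ` {..<3} \<subseteq> \<Union>H"
  proof (rule image_subsetI)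
    fix j :: nat assume "j \<in> {..<3}"
    then show "[x, y, z] ! j \<in> \<Union>H"
      using cols[of j] A A_iff by (metis UnionI lessThan_iff)
  qed
  ultimately show "found_in N H"
    unfolding found_in_def assms(1,2) using A_iff by blast
qed

lemma all_less_4_3:
  "(\<forall>i<4. P i) \<longleftrightarrow> P (0 :: nat) \<and> P 1 \<and> P 2 \<and> P 3" "(\<forall>i<3. P i) \<longleftrightarrow> P (0 :: nat) \<and> P 1 \<and> P 2"
  by (auto simp: less_4_3)

lemma ex_less_4: "(\<exists>i<4. P i) \<longleftrightarrow> P (0 :: nat) \<or> P 1 \<or> P 2 \<or> P 3"
  by (auto simp: less_4_3)

lemma found_in_singleton_mat_3_iff:
  "found_in (singleton_mat 3) H \<longleftrightarrow>
    (\<exists>x y z. distinct [x, y, z] \<and> trace H x y z False False False \<and> trace H x y z True False False \<and>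
      trace H x y z False True False \<and> trace H x y z False False True)"
proof (subst found_in_4_3_iff)
  let ?N = "singleton_mat 3"
  show "i = k" if "i < 4" "k < 4" "\<forall>j<3. ?N $$ (i, j) = 1 \<longleftrightarrow> ?N $$ (k, j) = 1" for i k
    using that unfolding less_4_3(1) all_less_4_3 by (elim disjE) (simp_all add: singleton_mat_def)
  show "\<exists>i<4. ?N $$ (i, j) = 1" if "j < 3" for j
    using that unfolding less_4_3(2) by (elim disjE) (simp_all add: singleton_mat_def ex_less_4)
qed (simp_all add: singleton_mat_def all_less_4_3)

lemma found_in_cosingleton_mat_3_iff:
  "found_in (cosingleton_mat 3) H \<longleftrightarrow>
    (\<exists>x y z. distinct [x, y, z] \<and> trace H x y z False True True \<and> trace H x y z True False True \<and>
      trace H x y z True True False \<and> trace H x y z True True True)"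
proof (subst found_in_4_3_iff)
  let ?N = "cosingleton_mat 3"
  show "i = k" if "i < 4" "k < 4" "\<forall>j<3. ?N $$ (i, j) = 1 \<longleftrightarrow> ?N $$ (k, j) = 1" for i k
    using that unfolding less_4_3(1) all_less_4_3 by (elim disjE) (simp_all add: cosingleton_mat_def)
  show "\<exists>i<4. ?N $$ (i, j) = 1" if "j < 3" for j
    using that unfolding less_4_3(2) by (elim disjE) (simp_all add: cosingleton_mat_def ex_less_4)
qed (simp_all add: cosingleton_mat_def all_less_4_3)

lemma found_in_monotone_mat_3_iff:
  "found_in (monotone_mat 3) H \<longleftrightarrow>
    (\<exists>x y z. distinct [x, y, z] \<and> trace H x y z False False False \<and> trace H x y z True False False \<and>
      trace H x y z True True False \<and> trace H x y z True True True)"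
proof (subst found_in_4_3_iff)
  let ?N = "monotone_mat 3"
  show "i = k" if "i < 4" "k < 4" "\<forall>j<3. ?N $$ (i, j) = 1 \<longleftrightarrow> ?N $$ (k, j) = 1" for i k
    using that unfolding less_4_3(1) all_less_4_3 by (elim disjE) (simp_all add: monotone_mat_def)
  show "\<exists>i<4. ?N $$ (i, j) = 1" if "j < 3" for j
    using that unfolding less_4_3(2) by (elim disjE) (simp_all add: monotone_mat_def ex_less_4)
qed (simp_all add: monotone_mat_def all_less_4_3)

lemma trace_swap:
  "trace H y x z q p r \<longleftrightarrow> trace H x y z p q r" "trace H x z y p r q \<longleftrightarrow> trace H x y z p q r"
  "trace H y z x q r p \<longleftrightarrow> trace H x y z p q r" "trace H z x y r p q \<longleftrightarrow> trace H x y z p q r"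
  "trace H z y x r q p \<longleftrightarrow> trace H x y z p q r"
  unfolding trace_def by blast+

definition contains_pattern :: "'a set set \<Rightarrow> bool" where
  "contains_pattern H \<longleftrightarrow>
    found_in (singleton_mat 3) H \<or> found_in (cosingleton_mat 3) H \<or> found_in (monotone_mat 3) H"

text \<open>Permuting the columns only permutes the rows of the singleton and cosingleton patterns;
  the six orders of the monotone pattern are carried back to \<open>x y z\<close> by
  \<open>trace_swap\<close>. So \<open>avoids\<close> depends only on the unordered triple, and the
  refutations below can use one order per triple.\<close>

lemma contains_pattern_iff:
  "contains_pattern H \<longleftrightarrow> (\<exists>x y z. distinct [x, y, z] \<and> \<not> avoids (trace H x y z))" (is "_ \<longleftrightarrow> ?R")
proof
  show "contains_pattern H \<Longrightarrow> ?R"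
    unfolding contains_pattern_def found_in_singleton_mat_3_iff found_in_cosingleton_mat_3_iff
      found_in_monotone_mat_3_iff avoids_def by blast
next
  assume ?R
  then obtain x y z where d: "distinct [x, y, z]" and n: "\<not> avoids (trace H x y z)"
    by blast
  let ?t = "trace H x y z"
  have mono: "found_in (monotone_mat 3) H"
    if "distinct [a, b, c]" "trace H a b c False False False" "trace H a b c True True True"
      "trace H a b c True False False" "trace H a b c True True False" for a b c
    using that found_in_monotone_mat_3_iff by blast
  have "found_in (singleton_mat 3) H"
    if "?t False False False \<and> ?t True False False \<and> ?t False True False \<and> ?t False False True"
    using that d found_in_singleton_mat_3_iff by blast
  moreover have "found_in (cosingleton_mat 3) H"
    if "?t True True True \<and> ?t False True True \<and> ?t True False True \<and> ?t True True False"
    using that d found_in_cosingleton_mat_3_iff by blast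
  ultimately show "contains_pattern H"
    using n d mono[of x y z] mono[of x z y] mono[of y x z] mono[of y z x] mono[of z x y] mono[of z y x]
    unfolding avoids_def contains_pattern_def by (auto simp: trace_swap[of H _ _ _])
qed

lemma contains_pattern_mono:
  assumes "H \<subseteq> H'" "contains_pattern H"
  shows "contains_pattern H'"
proof -
  obtain x y z where d: "distinct [x, y, z]" and n: "\<not> avoids (trace H x y z)"
    using assms(2) unfolding contains_pattern_iff by blast
  have "\<not> avoids (trace H' x y z)"
  proof
    assume "avoids (trace H' x y z)"
    then have "avoids (trace H x y z)"
      by (rule avoids_antimono) (use assms(1) in \<open>auto simp: trace_def\<close>)
    with n show False by (rule notE)
  qed
  with d have "\<exists>x y z. distinct [x, y, z] \<and> \<not> avoids (trace H' x y z)"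
    by blast
  then show ?thesis
    unfolding contains_pattern_iff .
qed

section \<open>Minimal separating sets\<close>

text \<open>In a separating set of least cardinality, dropping \<open>x\<close> must merge two
  members of \<open>H\<close>, and these differ within \<open>X\<close> exactly in
  \<open>x\<close>.\<close>

lemma ex_minimal_separating_set:
  assumes "finite H"
  obtains X where "finite X" "inj_on (\<lambda>A. A \<inter> X) H"
    "\<And>x. x \<in> X \<Longrightarrow> \<exists>A\<in>H. \<exists>B\<in>H. x \<notin> A \<and> x \<in> B \<and> (\<forall>y\<in>X - {x}. y \<in> A \<longleftrightarrow> y \<in> B)"
proof -
  let ?sep = "\<lambda>X. finite X \<and> inj_on (\<lambda>A. A \<inter> X) H"
  \<comment> \<open>\<open>d\<close> picks an element of the symmetric difference. Its arbitrary
    value on equal pairs affects neither finiteness nor separation.\<close>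
  define d where "d = (\<lambda>(A, B). SOME x :: 'a. x \<in> A \<longleftrightarrow> x \<notin> B)"
  have d: "d (A, B) \<in> A \<longleftrightarrow> d (A, B) \<notin> B" if "A \<noteq> B" for A B
  proof -
    have "\<exists>x. x \<in> A \<longleftrightarrow> x \<notin> B"
      using that by blast
    then show ?thesis
      unfolding d_def prod.case by (rule someI_ex)
  qed
  have "?sep (d ` (H \<times> H))"
  proof
    show "inj_on (\<lambda>A. A \<inter> d ` (H \<times> H)) H"
    proof (rule inj_onI, rule ccontr)
      fix A B assume AB: "A \<in> H" "B \<in> H" "A \<inter> d ` (H \<times> H) = B \<inter> d ` (H \<times> H)" "A \<noteq> B"
      have "d (A, B) \<in> d ` (H \<times> H)"
        using AB by blast
      then show False using d[OF AB(4)] AB(3) by blast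
    qed
  qed (use assms in simp)
  then obtain X where X: "?sep X" and min: "\<And>Y. ?sep Y \<Longrightarrow> card X \<le> card Y"
    using ex_has_least_nat[of ?sep _ card] by blast
  show thesis
  proof (rule that)
    fix x assume x: "x \<in> X"
    then have "card (X - {x}) < card X"
      using X by (meson card_Diff1_less)
    then have "\<not> inj_on (\<lambda>A. A \<inter> (X - {x})) H"
      using min[of "X - {x}"] X by auto
    then obtain A B where AB: "A \<in> H" "B \<in> H" "A \<noteq> B" "A \<inter> (X - {x}) = B \<inter> (X - {x})"
      by (auto simp: inj_on_def)
    then have "A \<inter> X \<noteq> B \<inter> X"
      using X by (auto dest: inj_onD)
    then have "x \<in> A \<longleftrightarrow> x \<notin> B"
      using AB(4) x by blast
    \<comment> \<open>The roles of \<open>A\<close> and \<open>B\<close> are exchanged if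
      \<open>x\<close> lies in \<open>A\<close>.\<close>
    then show "\<exists>A\<in>H. \<exists>B\<in>H. x \<notin> A \<and> x \<in> B \<and> (\<forall>y\<in>X - {x}. y \<in> A \<longleftrightarrow> y \<in> B)"
      using AB by blast
  qed (use X in auto)
qed

section \<open>Five irredundant elements are contradictory\<close>

text \<open>Given sets \<open>A\<^sub>x\<close> and \<open>B\<^sub>x\<close> for each of five elements \<open>x\<close> that differ in \<open>x\<close> but agree on the
  other four, \<open>E x y\<close> tells whether \<open>y\<close> lies in both \<open>A\<^sub>x\<close> and \<open>B\<^sub>x\<close>. The traces of these ten
  sets on \<open>x, y, z\<close> are then the ones listed here.\<close>

definition avoids_from :: "('a \<Rightarrow> 'a \<Rightarrow> bool) \<Rightarrow> 'a \<Rightarrow> 'a \<Rightarrow> 'a \<Rightarrow> 'a \<Rightarrow> 'a \<Rightarrow> bool" where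
  "avoids_from E x y z v w \<longleftrightarrow>
    avoids (\<lambda>p q r. E x y = q \<and> E x z = r \<or> E y x = p \<and> E y z = r \<or> E z x = p \<and> E z y = q \<or>
      E v x = p \<and> E v y = q \<and> E v z = r \<or> E w x = p \<and> E w y = q \<and> E w z = r)"

text \<open>The hypotheses run through the ten triples among the five elements. They involve only
  the twenty off-diagonal values of \<open>E\<close>, so this is a propositional refutation.\<close>

lemma avoids_from_five_False:
  assumes "avoids_from E a b c d e" "avoids_from E a b d c e" "avoids_from E a b e c d"
    "avoids_from E a c d b e" "avoids_from E a c e b d" "avoids_from E a d e b c"
    "avoids_from E b c d a e" "avoids_from E b c e a d" "avoids_from E b d e a c"
    "avoids_from E c d e a b"
  shows False
  using assms unfolding avoids_from_def avoids_def simp_thms by satx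

lemma ex_list_of_card:
  assumes "n \<le> card X"
  obtains xs where "distinct xs" "length xs = n" "set xs \<subseteq> X"
  using assms
  by (metis obtain_subset_with_card_n finite_distinct_list distinct_card)

lemma length_4_5_conv:
  "length xs = 4 \<longleftrightarrow> (\<exists>a b c d. xs = [a, b, c, d])" "length xs = 5 \<longleftrightarrow> (\<exists>a b c d e. xs = [a, b, c, d, e])"
  by (auto simp: numeral_eq_Suc length_Suc_conv)

lemma card_le_4_if_irredundant:
  assumes "\<not> contains_pattern H"
    and irr: "\<And>x. x \<in> X \<Longrightarrow> \<exists>A\<in>H. \<exists>B\<in>H. x \<notin> A \<and> x \<in> B \<and> (\<forall>y\<in>X - {x}. y \<in> A \<longleftrightarrow> y \<in> B)"
  shows "card X \<le> 4"
proof (rule ccontr)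
  assume "\<not> card X \<le> 4"
  then have "5 \<le> card X" by simp
  then obtain a b c d e where D: "distinct [a, b, c, d, e]" "set [a, b, c, d, e] \<subseteq> X"
    by (metis ex_list_of_card length_4_5_conv(2))
  obtain A B where AB: "\<And>x. x \<in> X \<Longrightarrow>
      A x \<in> H \<and> B x \<in> H \<and> x \<notin> A x \<and> x \<in> B x \<and> (\<forall>y\<in>X - {x}. y \<in> A x \<longleftrightarrow> y \<in> B x)"
    using irr by metis
  \<comment> \<open>Membership in \<open>A x\<close> serves as \<open>E x\<close>: for
    \<open>y\<close> in \<open>X\<close> other than \<open>x\<close>, it agrees with membership in
    \<open>B x\<close>.\<close>
  have "avoids_from (\<lambda>x y. y \<in> A x) x y z v w"
    if "distinct [x, y, z, v, w]" "set [x, y, z, v, w] \<subseteq> X" for x y z v w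
  proof -
    have "avoids (trace H x y z)"
      using assms(1) that(1) by (auto simp: contains_pattern_iff)
    moreover have "trace H x y z p q r"
      if "(y \<in> A x) = q \<and> (z \<in> A x) = r \<or> (x \<in> A y) = p \<and> (z \<in> A y) = r \<or>
        (x \<in> A z) = p \<and> (y \<in> A z) = q \<or> (x \<in> A v) = p \<and> (y \<in> A v) = q \<and> (z \<in> A v) = r \<or>
        (x \<in> A w) = p \<and> (y \<in> A w) = q \<and> (z \<in> A w) = r"
      for p q r
    proof -
      have "y \<noteq> x" "z \<noteq> x" "z \<noteq> y" "x \<noteq> y" "x \<noteq> z" "y \<noteq> z" "x \<in> X" "y \<in> X" "z \<in> X" "v \<in> X" "w \<in> X"
        using \<open>distinct [x, y, z, v, w]\<close> \<open>set [x, y, z, v, w] \<subseteq> X\<close> by auto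
      note this AB[OF this(7)] AB[OF this(8)] AB[OF this(9)] AB[OF this(10)] AB[OF this(11)]
      note AB' = this
      \<comment> \<open>Choosing between \<open>A x\<close> and \<open>B x\<close> realises either
        value at \<open>x\<close>, and likewise at \<open>y\<close> and \<open>z\<close>. On these
        three elements \<open>B v\<close> and \<open>B w\<close> have the same traces as
        \<open>A v\<close> and \<open>A w\<close>.\<close>
      have "\<exists>C\<in>{A x, B x, A y, B y, A z, B z, A v, A w}. (x \<in> C) = p \<and> (y \<in> C) = q \<and> (z \<in> C) = r"
        using that by (elim disjE; cases p; cases q; cases r) (simp_all add: AB')
      then show ?thesis
        unfolding trace_def using AB' by blast
    qed
    ultimately show ?thesis
      unfolding avoids_from_def by (rule avoids_antimono)
  qed
  with D show False
    by (intro avoids_from_five_False[of "\<lambda>x y. y \<in> A x" a b c d e]) auto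
qed

section \<open>Exhaustive search on four elements\<close>

definition list_trace :: "bool list list \<Rightarrow> nat \<Rightarrow> nat \<Rightarrow> nat \<Rightarrow> bool \<Rightarrow> bool \<Rightarrow> bool \<Rightarrow> bool" where
  "list_trace vs i j k = (let us = map (\<lambda>v. [v ! i, v ! j, v ! k]) vs in (\<lambda>p q r. [p, q, r] \<in> set us))"

definition bad :: "bool list list \<Rightarrow> bool" where
  "bad vs \<longleftrightarrow> list_ex (\<lambda>(i, j, k). \<not> avoids (list_trace vs i j k))
     [(0, 1, 2), (0, 1, 3), (0, 2, 3), (1, 2, 3)]"

text \<open>A branching search certifying that \<open>us\<close> cannot be extended by
  \<open>n\<close> vectors from the list without becoming \<open>bad\<close>. A branch is cut when
  too few vectors remain or when the new vector completes a pattern.\<close>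

fun no_extension :: "nat \<Rightarrow> bool list list \<Rightarrow> bool list list \<Rightarrow> bool" where
  "no_extension n us [] \<longleftrightarrow> 0 < n"
| "no_extension n us (v # vs) \<longleftrightarrow> Suc (length vs) < n \<or>
     (bad (v # us) \<or> no_extension (n - 1) (v # us) vs) \<and> no_extension n us vs"

text \<open>Quantifying over all lists drawn from \<open>us\<close> and \<open>S\<close> makes the
  assumption independent of the order in which the search adds vectors, and avoids a monotonicity
  argument for \<open>bad\<close>.\<close>

lemma no_extension_card:
  assumes "no_extension n us vs" "S \<subseteq> set vs"
    "\<And>ws. set ws \<subseteq> set us \<union> S \<Longrightarrow> \<not> bad ws"
  shows "card S < n"
  using assms
proof (induction n us vs arbitrary: S rule: no_extension.induct)
  case (2 n us v vs)
  have len: "card S \<le> Suc (length vs)"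
    using 2(4) by (metis card_length card_mono finite_set le_trans length_Cons)
  show ?case
  proof (cases "Suc (length vs) < n")
    case False
    show ?thesis
    proof (cases "v \<in> S")
      case True
      then have "\<not> bad (v # us)"
        by (intro 2(5)) auto
      \<comment> \<open>Moving \<open>v\<close> from \<open>S\<close> to \<open>us\<close> leaves
        their union, and hence the assumption on lists, unchanged.\<close>
      then have "card (S - {v}) < n - 1"
        using 2(3,4) True False by (intro 2(1)) (auto intro!: 2(5))
      moreover have "finite S"
        using 2(4) finite_subset by blast
      ultimately show ?thesis
        using True by (simp add: card_Diff_singleton)
    next
      case notin: False
      then show ?thesis
        using 2(3-5) False by (intro 2(2)) auto
    qed
  qed (use len in simp)
qed auto

text \<open>Listing the traces of even size first makes the search prune much earlier.\<close>

definition traces_4 :: "bool list list" where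
  "traces_4 = (let vs = List.n_lists 4 [False, True]; ev = (\<lambda>v. even (length (filter id v)))
     in filter ev vs @ filter (Not \<circ> ev) vs)"

lemma set_traces_4: "set traces_4 = {v. length v = 4}"
  by (auto simp: traces_4_def Let_def set_n_lists)

lemma no_extension_traces_4: "no_extension 9 [] traces_4"
  by code_simp

text \<open>Each projected vector is realised by a member of \<open>H\<close>, so the list has no
  traces beyond those of \<open>H\<close>.\<close>

lemma avoids_list_trace:
  assumes "\<not> contains_pattern H" "distinct xs" "i < length xs" "j < length xs" "k < length xs"
    "distinct [i, j, k]" "set vs \<subseteq> (\<lambda>A. map (\<lambda>x. x \<in> A) xs) ` H"
  shows "avoids (list_trace vs i j k)"
proof (rule avoids_antimono)
  have "distinct [xs ! i, xs ! j, xs ! k]"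
    using assms(2-6) by (simp add: nth_eq_iff_index_eq)
  then show "avoids (trace H (xs ! i) (xs ! j) (xs ! k))"
    using assms(1) unfolding contains_pattern_iff by blast
  show "trace H (xs ! i) (xs ! j) (xs ! k) p q r" if "list_trace vs i j k p q r" for p q r
    using that assms(3-5,7) by (fastforce simp: list_trace_def trace_def)
qed

lemma card_le_8_if_separated_by_4:
  assumes "\<not> contains_pattern H" "distinct xs" "length xs = 4" "inj_on (\<lambda>A. A \<inter> set xs) H"
  shows "card H \<le> 8"
proof -
  let ?f = "\<lambda>A. map (\<lambda>x. x \<in> A) xs"
  have "inj_on ?f H"
    using assms(4) by (fastforce simp: inj_on_def)
  moreover have "card (?f ` H) < 9"
  proof (rule no_extension_card[OF no_extension_traces_4])
    show "?f ` H \<subseteq> set traces_4"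
      using assms(3) by (auto simp: set_traces_4)
    show "\<not> bad ws" if "set ws \<subseteq> set [] \<union> ?f ` H" for ws
      using that assms(3) avoids_list_trace[OF assms(1,2), of _ _ _ ws] by (simp add: bad_def)
  qed
  ultimately show ?thesis
    by (simp add: card_image)
qed

section \<open>The upper bound\<close>

lemma contains_pattern_if_card_ge_9:
  assumes "infinite H \<or> 9 \<le> card H"
  shows "contains_pattern H"
proof (rule ccontr)
  assume free: "\<not> contains_pattern H"
  \<comment> \<open>Exactly nine sets are kept, so that a finite separating set exists even if
    \<open>H\<close> is infinite.\<close>
  obtain H' where H': "H' \<subseteq> H" "finite H'" "card H' = 9"
    using assms by (metis infinite_arbitrarily_large obtain_subset_with_card_n)
  with free have free': "\<not> contains_pattern H'"
    using contains_pattern_mono by blast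
  obtain X where X: "finite X" "inj_on (\<lambda>A. A \<inter> X) H'"
    "\<And>x. x \<in> X \<Longrightarrow> \<exists>A\<in>H'. \<exists>B\<in>H'. x \<notin> A \<and> x \<in> B \<and> (\<forall>y\<in>X - {x}. y \<in> A \<longleftrightarrow> y \<in> B)"
    using ex_minimal_separating_set[OF H'(2)] by blast
  have "card X \<le> 4"
    using card_le_4_if_irredundant[OF free' X(3)] by blast
  \<comment> \<open>Nine distinct traces need nine subsets of \<open>X\<close>, so \<open>X\<close>
    has exactly the four elements that the search assumes.\<close>
  moreover have "(9 :: nat) \<le> 2 ^ card X"
  proof -
    have "card H' \<le> card (Pow X)"
      using X(1,2) by (intro card_inj_on_le[of "\<lambda>A. A \<inter> X"]) auto
    then show ?thesis using H'(3) X(1) by (simp add: card_Pow)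
  qed
  then have "\<not> card X \<le> 3"
    using power_increasing[of "card X" 3 "2::nat"] by auto
  ultimately have "card X = 4" by simp
  then obtain xs where "distinct xs" "length xs = 4" "set xs = X"
    using X(1) by (metis finite_distinct_list distinct_card)
  then have "card H' \<le> 8"
    using card_le_8_if_separated_by_4[OF free'] X(2) by metis
  with H'(3) show False by simp
qed

section \<open>Sharpness of the bound\<close>

text \<open>Found by computer search.\<close>

definition extremal :: "bool list list" where
  "extremal = (let f = False; t = True in
    [[f,f,f,t], [f,f,t,f], [f,f,t,t], [f,t,f,t], [f,t,t,t], [t,f,t,f], [t,f,t,t], [t,t,f,f]])"

text \<open>All ordered index triples are checked, so arbitrary distinct \<open>x\<close>,
  \<open>y\<close>, \<open>z\<close> from the ground list need no sorting.\<close>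

lemma avoids_extremal:
  "list_all (\<lambda>i. list_all (\<lambda>j. list_all (\<lambda>k. distinct [i, j, k] \<longrightarrow>
     avoids (list_trace extremal i j k)) [0..<4]) [0..<4]) [0..<4]"
  by code_simp

lemma ex_pattern_free_of_card_8:
  "\<exists>H :: 'a::infinite set set. finite H \<and> card H = 8 \<and> \<not> contains_pattern H"
proof -
  obtain xs :: "'a list" where xs: "distinct xs" "length xs = 4"
    by (metis infinite_UNIV infinite_arbitrarily_large finite_distinct_list distinct_card)
  define f where "f v = {xs ! i | i. i < 4 \<and> v ! i}" for v
  have mem: "xs ! i \<in> f v \<longleftrightarrow> v ! i" if "i < 4" for i v
    using that xs by (auto simp: f_def nth_eq_iff_index_eq)
  have len: "length v = 4" if "v \<in> set extremal" for v
    using that by (auto simp: extremal_def Let_def)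
  define H where "H = f ` set extremal"
  have "inj_on f (set extremal)"
  proof (rule inj_onI)
    fix v w assume "v \<in> set extremal" "w \<in> set extremal" "f v = f w"
    then show "v = w"
      using mem[of _ v] mem[of _ w] by (intro nth_equalityI) (simp_all add: len)
  qed
  moreover have "card (set extremal) = 8"
  proof -
    have "distinct extremal" "length extremal = 8"
      by code_simp+
    then show ?thesis
      by (simp add: distinct_card)
  qed
  ultimately have "card H = 8"
    by (simp add: H_def card_image)
  moreover have "\<not> contains_pattern H"
  proof
    assume "contains_pattern H"
    then obtain x y z where d: "distinct [x, y, z]" and n: "\<not> avoids (trace H x y z)"
      unfolding contains_pattern_iff by blast
    \<comment> \<open>Every forbidden pattern has a \<open>True\<close> in each coordinate, so all
      three elements lie in \<open>\<Union>H\<close> and thus in the list \<open>xs\<close>. The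
      all-\<open>False\<close> trace says nothing, which leaves seven instances.\<close>
    have "(p \<longrightarrow> x \<in> \<Union>H) \<and> (q \<longrightarrow> y \<in> \<Union>H) \<and> (r \<longrightarrow> z \<in> \<Union>H)" if "trace H x y z p q r" for p q r
      using that unfolding trace_def by blast
    note this[of True False False] this[of False True False] this[of False False True]
      this[of True True False] this[of True False True] this[of False True True] this[of True True True]
    then have "x \<in> \<Union>H \<and> y \<in> \<Union>H \<and> z \<in> \<Union>H"
      using n unfolding avoids_def simp_thms by satx
    then obtain i j k where ijk: "i < 4" "j < 4" "k < 4" "x = xs ! i" "y = xs ! j" "z = xs ! k"
      by (auto simp: H_def f_def)
    then have "distinct [i, j, k]"
      using d by auto
    then have "avoids (list_trace extremal i j k)"
      using avoids_extremal ijk(1-3) by (simp add: list_all_iff)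
    then have "avoids (trace H x y z)"
    proof (rule avoids_antimono)
      show "list_trace extremal i j k p q r" if "trace H x y z p q r" for p q r
        using that mem ijk by (auto simp: trace_def list_trace_def H_def)
    qed
    with n show False by (rule notE)
  qed
  ultimately show ?thesis
    by (intro exI[of _ H]) (simp add: H_def)
qed

theorem proposition2:
  "(\<forall>H :: 'a set set. infinite H \<or> card H \<ge> 9 \<longrightarrow>
      found_in (singleton_mat 3) H \<or> found_in (cosingleton_mat 3) H \<or> found_in (monotone_mat 3) H)
   \<and> S_num TYPE('b::infinite) 2 2 = 8"
proof
  show "\<forall>H :: 'a set set. infinite H \<or> card H \<ge> 9 \<longrightarrow>
      found_in (singleton_mat 3) H \<or> found_in (cosingleton_mat 3) H \<or> found_in (monotone_mat 3) H"
    using contains_pattern_if_card_ge_9 unfolding contains_pattern_def by blast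
  have "S_num TYPE('b) 2 2 = (LEAST s. \<forall>H :: 'b set set. infinite H \<or> card H > s \<longrightarrow> contains_pattern H)"
    by (simp add: S_num_def contains_pattern_def)
  also have "\<dots> = 8"
  proof (rule Least_equality)
    show "\<forall>H :: 'b set set. infinite H \<or> card H > 8 \<longrightarrow> contains_pattern H"
      using contains_pattern_if_card_ge_9 by fastforce
    \<comment> \<open>If \<open>s < 8\<close>, the pattern-free family of eight sets has more than
      \<open>s\<close> members.\<close>
    show "8 \<le> s" if "\<forall>H :: 'b set set. infinite H \<or> card H > s \<longrightarrow> contains_pattern H" for s
      using that ex_pattern_free_of_card_8[where ?'a = 'b] by (metis not_le)
  qed
  finally show "S_num TYPE('b) 2 2 = 8" .
qed

end
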